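(* The set $K_{\mathsf{DTS}} = \{v \geq 3 : \text{there exists a DTS}(v)\text{ having a } v\text{-good sequencing}\}$ is PBD-closed; that is, whenever there exists a $(v, K_{\mathsf{DTS}})$-PBD, we have $v \in K_{\mathsf{DTS}}$.
   Context: A transitive triple is an ordered triple $(x,y,z)$ of distinct elements; it contains the directed edges $(x,y)$, $(x,z)$, $(y,z)$. A directed triple system of order $v$, DTS$(v)$, is a pair $(X,\mathcal{B})$ where $X$ is a set of $v$ points and $\mathcal{B}$ is a set of transitive triples of elements of $X$ such that every ordered pair $(a,b)$ of distinct points of $X$ occurs as a directed edge in exactly one triple of $\mathcal{B}$. A $v$-good sequencing of a DTS$(v)$ $(X,\mathcal{B})$ is a permutation $[x_1\, x_2\, \cdots\, x_v]$ of $X$ such that for no triple $(x,y,z)\in\mathcal{B}$ do we have $x=x_i$, $y=x_j$, $z=x_k$ with $i<j<k$. For a set $K$ of integers $\geq 2$, a $(v,K)$-PBD (pairwise balanced design) is a pair $(X,\mathcal{B})$ with $|X|=v$ and $\mathcal{B}$ a set of subsets (blocks) of $X$ such that every pair of distinct points lies in exactly one block and $|B|\in K$ for every $B\in\mathcal{B}$. $K$ is PBD-closed if $v\in K$ whenever a $(v,K)$-PBD exists.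
   Formalization: The formal statement requires a PBD to have v ≥ 2 points; for v = 0 or v = 1 the empty block set would be a PBD for any K, and the claim would fail because all members of K_DTS are at least 3. *)

theory Defs
  imports "HOL-Combinatorics.Multiset_Permutations"
begin

fun directed_edges :: "'a \<times> 'a \<times> 'a \<Rightarrow> ('a \<times> 'a) set" where
  "directed_edges (x, y, z) = {(x, y), (x, z), (y, z)}"

definition transitive_triples :: "'a set \<Rightarrow> ('a \<times> 'a \<times> 'a) set" where
  "transitive_triples X =
     {(x, y, z). x \<in> X \<and> y \<in> X \<and> z \<in> X \<and> x \<noteq> y \<and> x \<noteq> z \<and> y \<noteq> z}"

definition is_DTS :: "nat \<Rightarrow> 'a set \<Rightarrow> ('a \<times> 'a \<times> 'a) set \<Rightarrow> bool" where
  "is_DTS v X \<B> \<longleftrightarrow>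
     finite X \<and> card X = v \<and> \<B> \<subseteq> transitive_triples X \<and>
     (\<forall>a\<in>X. \<forall>b\<in>X. a \<noteq> b \<longrightarrow> (\<exists>!T\<in>\<B>. (a, b) \<in> directed_edges T))"

definition good_sequencing ::
    "'a set \<Rightarrow> ('a \<times> 'a \<times> 'a) set \<Rightarrow> 'a list \<Rightarrow> bool" where
  "good_sequencing X \<B> xs \<longleftrightarrow>
     xs \<in> permutations_of_set X \<and>
     \<not> (\<exists>(x, y, z)\<in>\<B>. \<exists>i j k. i < j \<and> j < k \<and> k < length xs \<and>
          x = xs ! i \<and> y = xs ! j \<and> z = xs ! k)"

text \<open>
  Points are taken to be natural numbers in the existential definitions below. Since all point
  sets are finite, this is no restriction: see the transfer lemmas at the end of the theory.
\<close>

definition K_DTS :: "nat set" where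
  "K_DTS = {v. 3 \<le> v \<and>
     (\<exists>(X :: nat set) \<B>. is_DTS v X \<B> \<and> (\<exists>xs. good_sequencing X \<B> xs))}"

text \<open>
  At least two points are required, as is usual for pairwise balanced designs: on zero points or one
  point the empty collection of blocks satisfies the other conditions for every set of block sizes,
  so that no set of integers greater than 1 would be PBD-closed.
\<close>

definition is_PBD :: "nat \<Rightarrow> nat set \<Rightarrow> 'a set \<Rightarrow> 'a set set \<Rightarrow> bool" where
  "is_PBD v K X \<B> \<longleftrightarrow>
     2 \<le> v \<and> K \<subseteq> {2..} \<and> finite X \<and> card X = v \<and> \<B> \<subseteq> Pow X \<and>
     (\<forall>x\<in>X. \<forall>y\<in>X. x \<noteq> y \<longrightarrow> (\<exists>!B\<in>\<B>. {x, y} \<subseteq> B)) \<and>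
     (\<forall>B\<in>\<B>. card B \<in> K)"

definition PBD_closed :: "nat set \<Rightarrow> bool" where
  "PBD_closed K \<longleftrightarrow> (\<forall>v. (\<exists>(X :: nat set) \<B>. is_PBD v K X \<B>) \<longrightarrow> v \<in> K)"

lemma ex1_image:
  assumes "\<exists>!x\<in>A. P x" "\<And>x. x \<in> A \<Longrightarrow> Q (g x) \<longleftrightarrow> P x"
  shows "\<exists>!y\<in>g ` A. Q y"
proof -
  obtain x where x: "x \<in> A" "P x" "\<And>x'. x' \<in> A \<Longrightarrow> P x' \<Longrightarrow> x' = x"
    using assms(1) by blast
  show ?thesis
  proof (rule ex1I)
    show "g x \<in> g ` A \<and> Q (g x)" using x(1,2) assms(2)[of x] by blast
  next
    fix y assume "y \<in> g ` A \<and> Q y"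
    then obtain x' where "x' \<in> A" "y = g x'" "Q (g x')" by blast
    then show "y = g x" using x(3)[of x'] assms(2)[of x'] by blast
  qed
qed

lemma is_DTS_image:
  assumes "is_DTS v X \<B>" and f: "inj_on f X"
  shows "is_DTS v (f ` X) (map_prod f (map_prod f f) ` \<B>)"
proof -
  let ?F = "map_prod f (map_prod f f)"
  have X: "finite X" "card X = v" and B: "\<B> \<subseteq> transitive_triples X"
    and E: "\<And>a b. a \<in> X \<Longrightarrow> b \<in> X \<Longrightarrow> a \<noteq> b \<Longrightarrow> \<exists>!T\<in>\<B>. (a, b) \<in> directed_edges T"
    using assms(1) unfolding is_DTS_def by auto
  have edge: "(f a, f b) \<in> directed_edges (?F T) \<longleftrightarrow> (a, b) \<in> directed_edges T"
    if "T \<in> \<B>" "a \<in> X" "b \<in> X" for T a b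
  proof -
    have "T \<in> transitive_triples X" using that B by blast
    then show ?thesis
      using that unfolding transitive_triples_def by (auto simp: inj_on_eq_iff[OF f])
  qed
  have "?F ` \<B> \<subseteq> transitive_triples (f ` X)"
  proof (rule image_subsetI)
    fix T assume "T \<in> \<B>"
    then have "T \<in> transitive_triples X" using B by blast
    then show "?F T \<in> transitive_triples (f ` X)"
      unfolding transitive_triples_def by (auto simp: inj_on_eq_iff[OF f])
  qed
  moreover have "\<exists>!T\<in>?F ` \<B>. (f a, f b) \<in> directed_edges T"
    if "a \<in> X" "b \<in> X" "f a \<noteq> f b" for a b
  proof (rule ex1_image[where P = "\<lambda>T. (a, b) \<in> directed_edges T"])
    show "\<exists>!T\<in>\<B>. (a, b) \<in> directed_edges T" using E that by metis
  qed (rule edge[OF _ that(1,2)])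
  ultimately show ?thesis
    using X f unfolding is_DTS_def by (simp add: card_image)
qed

lemma good_sequencing_image:
  assumes "good_sequencing X \<B> xs" "\<B> \<subseteq> transitive_triples X" and f: "inj_on f X"
  shows "good_sequencing (f ` X) (map_prod f (map_prod f f) ` \<B>) (map f xs)"
proof -
  have xs: "set xs = X" "distinct xs"
    using assms(1) by (simp_all add: good_sequencing_def permutations_of_set_def)
  have good: False
    if "(x, y, z) \<in> \<B>" "i < j" "j < k" "k < length xs"
      "x = xs ! i" "y = xs ! j" "z = xs ! k" for x y z i j k
    using assms(1) that unfolding good_sequencing_def by blast
  have False
    if "(x, y, z) \<in> \<B>" "i < j" "j < k" "k < length xs"
      "f x = map f xs ! i" "f y = map f xs ! j" "f z = map f xs ! k" for x y z i j k
  proof -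
    have "x \<in> X" "y \<in> X" "z \<in> X"
      using that(1) assms(2) unfolding transitive_triples_def by auto
    moreover have "xs ! i \<in> X" "xs ! j \<in> X" "xs ! k \<in> X"
      using that xs(1) by auto
    ultimately have "x = xs ! i" "y = xs ! j" "z = xs ! k"
      using that by (simp_all add: inj_on_eq_iff[OF f])
    then show False by (rule good[OF that(1-4)])
  qed
  then have "\<not> (\<exists>(x, y, z)\<in>map_prod f (map_prod f f) ` \<B>. \<exists>i j k. i < j \<and> j < k \<and>
      k < length (map f xs) \<and> x = map f xs ! i \<and> y = map f xs ! j \<and> z = map f xs ! k)"
    by (auto simp del: nth_map)
  then show ?thesis
    using xs f unfolding good_sequencing_def permutations_of_set_def
    by (simp add: distinct_map)
qed

lemma is_PBD_image:
  assumes "is_PBD v K X \<B>" and f: "inj_on f X"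
  shows "is_PBD v K (f ` X) ((`) f ` \<B>)"
proof -
  have X: "2 \<le> v" "K \<subseteq> {2..}" "finite X" "card X = v" and B: "\<B> \<subseteq> Pow X"
    and K: "\<And>B. B \<in> \<B> \<Longrightarrow> card B \<in> K"
    and E: "\<And>a b. a \<in> X \<Longrightarrow> b \<in> X \<Longrightarrow> a \<noteq> b \<Longrightarrow> \<exists>!B\<in>\<B>. {a, b} \<subseteq> B"
    using assms(1) unfolding is_PBD_def by auto
  have sub: "{f a, f b} \<subseteq> f ` B \<longleftrightarrow> {a, b} \<subseteq> B" if "B \<in> \<B>" "a \<in> X" "b \<in> X" for B a b
  proof -
    have "B \<subseteq> X" using that B by blast
    then show ?thesis using that f by (simp add: inj_on_image_mem_iff)
  qed
  have "\<exists>!C\<in>(`) f ` \<B>. {f a, f b} \<subseteq> C" if "a \<in> X" "b \<in> X" "f a \<noteq> f b" for a b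
  proof (rule ex1_image[where P = "\<lambda>B. {a, b} \<subseteq> B"])
    show "\<exists>!B\<in>\<B>. {a, b} \<subseteq> B" using E that by metis
  qed (rule sub[OF _ that(1,2)])
  moreover have "card (f ` B) \<in> K" if "B \<in> \<B>" for B
    using that B K f by (metis PowD card_image inj_on_subset subsetD)
  moreover have "(`) f ` \<B> \<subseteq> Pow (f ` X)" using B by blast
  ultimately show ?thesis
    using X f unfolding is_PBD_def by (simp add: card_image)
qed

lemma K_DTS_I:
  fixes X :: "'a set"
  assumes "3 \<le> v" "is_DTS v X \<B>" "good_sequencing X \<B> xs"
  shows "v \<in> K_DTS"
proof -
  obtain f :: "'a \<Rightarrow> nat" where f: "inj_on f X"
    using assms(2) finite_imp_inj_to_nat_seg[of X] by (auto simp: is_DTS_def)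
  have "\<B> \<subseteq> transitive_triples X"
    using assms(2) by (simp add: is_DTS_def)
  note good_sequencing_image[OF assms(3) this f]
  with assms(1) is_DTS_image[OF assms(2) f] show ?thesis
    unfolding K_DTS_def by (intro CollectI conjI exI)
qed

lemma PBD_closedD:
  fixes X :: "'a set"
  assumes "PBD_closed K" "is_PBD v K X \<B>"
  shows "v \<in> K"
proof -
  obtain f :: "'a \<Rightarrow> nat" where f: "inj_on f X"
    using assms(2) finite_imp_inj_to_nat_seg[of X] by (auto simp: is_PBD_def)
  show ?thesis
    by (rule assms(1)[unfolded PBD_closed_def, rule_format])
      (intro exI, rule is_PBD_image[OF assms(2) f])
qed

end

(* The points can be taken to be natural numbers, so a single linear order restricts to all blocks
   of the PBD. On each block, relabel a DTS so that its good sequencing becomes the increasing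
   order of the block. The union of these DTSs is a DTS on the whole point set, and the increasing
   order is a good sequencing of it because every triple lies inside one block. *)

theory Submission
  imports Defs
begin

lemma directed_edges_points:
  assumes "T \<in> transitive_triples X" "(a, b) \<in> directed_edges T"
  shows "a \<in> X" "b \<in> X"
  using assms unfolding transitive_triples_def by auto

lemma transitive_triples_mono: "X \<subseteq> Y \<Longrightarrow> transitive_triples X \<subseteq> transitive_triples Y"
  unfolding transitive_triples_def by auto

text \<open>Indexing into the sorted list is strictly increasing, so comparing positions amounts to
  comparing points. The resulting condition concerns each triple alone and no longer mentions the
  point set, which lets it pass from the blocks to the whole design.\<close>

lemma good_sequencing_sorted_list_of_set:
  fixes X :: "'a::linorder set"
  assumes "finite X" "\<B> \<subseteq> transitive_triples X"
  shows "good_sequencing X \<B> (sorted_list_of_set X) \<longleftrightarrow> (\<forall>(x, y, z)\<in>\<B>. \<not> (x < y \<and> y < z))"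
proof -
  let ?s = "sorted_list_of_set X"
  have s: "set ?s = X" "distinct ?s"
    using assms(1) by simp_all
  have "strict_mono_on {..<length ?s} ((!) ?s)"
    using sorted_wrt_nth_less[OF strict_sorted_list_of_set[of X]]
    by (simp add: strict_mono_on_def)
  then have less: "?s ! i < ?s ! j \<longleftrightarrow> i < j" if "i < length ?s" "j < length ?s" for i j
    using that by (simp add: strict_mono_on_less)
  have "(\<exists>i j k. i < j \<and> j < k \<and> k < length ?s \<and> x = ?s ! i \<and> y = ?s ! j \<and> z = ?s ! k)
      \<longleftrightarrow> x < y \<and> y < z" (is "?L \<longleftrightarrow> _") if "(x, y, z) \<in> \<B>" for x y z
  proof
    assume ?L
    then show "x < y \<and> y < z" using less by auto
  next
    assume lt: "x < y \<and> y < z"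
    \<comment> \<open>The points of a triple have positions in the list only because the triple lies
      in \<open>X\<close>.\<close>
    have "x \<in> X" "y \<in> X" "z \<in> X"
      using that assms(2) unfolding transitive_triples_def by auto
    then obtain i j k where "i < length ?s" "j < length ?s" "k < length ?s"
      "x = ?s ! i" "y = ?s ! j" "z = ?s ! k"
      using s(1) by (metis in_set_conv_nth)
    moreover from this have "i < j" "j < k" using lt less by blast+
    ultimately show ?L by blast
  qed
  then have "(\<exists>(x, y, z)\<in>\<B>. \<exists>i j k. i < j \<and> j < k \<and> k < length ?s \<and>
      x = ?s ! i \<and> y = ?s ! j \<and> z = ?s ! k) \<longleftrightarrow> (\<exists>(x, y, z)\<in>\<B>. x < y \<and> y < z)"
    by (intro bex_cong refl) (simp add: split_beta)
  moreover have "?s \<in> permutations_of_set X"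
    using s by (simp add: permutations_of_set_def)
  ultimately show ?thesis
    unfolding good_sequencing_def by blast
qed

lemma ex_map_eq:
  assumes "distinct xs" "length xs = length ys"
  shows "\<exists>f. map f xs = ys"
proof
  \<comment> \<open>Only values at entries of \<open>xs\<close> matter. There \<open>map_of\<close>
    is defined, and distinctness makes it return the entry of \<open>ys\<close> at the same
    position.\<close>
  show "map (\<lambda>x. the (map_of (zip xs ys) x)) xs = ys"
    using assms by (intro nth_equalityI) (simp_all add: map_of_zip_nth)
qed

lemma K_DTS_sorted_list_of_set:
  fixes X :: "'a::linorder set"
  assumes "finite X" "card X \<in> K_DTS"
  shows "\<exists>\<B>. is_DTS (card X) X \<B> \<and> good_sequencing X \<B> (sorted_list_of_set X)"
proof -
  obtain Y :: "nat set" and \<C> ys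
    where Y: "is_DTS (card X) Y \<C>" "good_sequencing Y \<C> ys"
    using assms(2) unfolding K_DTS_def by blast
  have ys: "set ys = Y" "distinct ys"
    using Y(2) by (simp_all add: good_sequencing_def permutations_of_set_def)
  have C: "\<C> \<subseteq> transitive_triples Y" and "card Y = card X"
    using Y(1) by (simp_all add: is_DTS_def)
  then have "length ys = length (sorted_list_of_set X)"
    using ys distinct_card[of ys] by simp
  then obtain f where f: "map f ys = sorted_list_of_set X"
    using ex_map_eq ys(2) by blast
  \<comment> \<open>Since \<open>f\<close> carries \<open>ys\<close> to a list without repetitions,
    it is injective on \<open>Y\<close>; comparing the sets of entries shows that it maps
    \<open>Y\<close> onto \<open>X\<close>.\<close>
  then have "distinct (map f ys)" by simp
  then have inj: "inj_on f Y" using ys(1) by (simp add: distinct_map)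
  have img: "f ` Y = X"
    using arg_cong[OF f, of set] ys(1) assms(1) by simp
  show ?thesis
    using is_DTS_image[OF Y(1) inj] good_sequencing_image[OF Y(2) C inj]
    unfolding img f by blast
qed

lemma is_DTS_Union:
  assumes PBD: "is_PBD v K X \<B>"
    and DTS: "\<And>B. B \<in> \<B> \<Longrightarrow> is_DTS (card B) B (\<T> B)"
  shows "is_DTS v X (\<Union>B\<in>\<B>. \<T> B)"
proof -
  have T: "\<T> B \<subseteq> transitive_triples B" if "B \<in> \<B>" for B
    using DTS[OF that] by (simp add: is_DTS_def)
  have BX: "B \<subseteq> X" if "B \<in> \<B>" for B
    using PBD that unfolding is_PBD_def by auto
  have "\<exists>!T\<in>\<Union>B\<in>\<B>. \<T> B. (a, b) \<in> directed_edges T"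
    if ab: "a \<in> X" "b \<in> X" "a \<noteq> b" for a b
  proof -
    have "\<exists>!B\<in>\<B>. {a, b} \<subseteq> B"
      using PBD ab unfolding is_PBD_def by simp
    then obtain B where B: "B \<in> \<B>" "a \<in> B" "b \<in> B"
      and uniq: "\<And>C. C \<in> \<B> \<Longrightarrow> a \<in> C \<Longrightarrow> b \<in> C \<Longrightarrow> C = B"
      by (metis empty_subsetI insert_subset)
    have "\<exists>!T\<in>\<T> B. (a, b) \<in> directed_edges T"
      using DTS[OF B(1)] B ab(3) unfolding is_DTS_def by simp
    \<comment> \<open>A triple with edge \<open>(a, b)\<close> has both endpoints in its own block,
      so it can only come from the one block through \<open>a\<close> and \<open>b\<close>.\<close>
    moreover have "C = B" if "C \<in> \<B>" "T \<in> \<T> C" "(a, b) \<in> directed_edges T" for C T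
    proof -
      have "T \<in> transitive_triples C" using T that by blast
      then show ?thesis using uniq that(1,3) directed_edges_points by metis
    qed
    ultimately show ?thesis using B(1) by blast
  qed
  moreover have "(\<Union>B\<in>\<B>. \<T> B) \<subseteq> transitive_triples X"
    using T transitive_triples_mono[OF BX] by (intro UN_least) (rule subset_trans)
  ultimately show ?thesis
    using PBD unfolding is_DTS_def is_PBD_def by simp
qed

theorem theorem2p1:
  shows "PBD_closed K_DTS"
  unfolding PBD_closed_def
proof (intro allI impI, elim exE)
  fix v and X :: "nat set" and \<B>
  assume PBD: "is_PBD v K_DTS X \<B>"
  have X: "finite X" "card X = v" "2 \<le> v"
    using PBD by (simp_all add: is_PBD_def)
  have BX: "B \<subseteq> X" and K: "card B \<in> K_DTS" if "B \<in> \<B>" for B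
    using PBD that unfolding is_PBD_def by auto
  \<comment> \<open>A PBD has at least two points. The block through two of them has its size in
    \<open>K_DTS\<close>, hence at least 3 points, and this forces 3 \<le> \<open>v\<close>.\<close>
  obtain a b where "a \<in> X" "b \<in> X" "a \<noteq> b"
    using X by (metis card_le_Suc0_iff_eq not_less_eq_eq numeral_2_eq_2)
  then have "\<exists>!B\<in>\<B>. {a, b} \<subseteq> B"
    using PBD unfolding is_PBD_def by simp
  then obtain B where B: "B \<in> \<B>" by blast
  then have "3 \<le> card B"
    using K unfolding K_DTS_def by blast
  also have "card B \<le> v"
    using X BX[OF B] card_mono by blast
  finally have "3 \<le> v" .
  have fin: "finite B" if "B \<in> \<B>" for B
    using BX[OF that] X(1) finite_subset by blast
  then have "\<forall>B\<in>\<B>. \<exists>\<T>. is_DTS (card B) B \<T> \<and> good_sequencing B \<T> (sorted_list_of_set B)"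
    using K_DTS_sorted_list_of_set K by blast
  then obtain \<T> where T: "\<And>B. B \<in> \<B> \<Longrightarrow> is_DTS (card B) B (\<T> B)"
    and good: "\<And>B. B \<in> \<B> \<Longrightarrow> good_sequencing B (\<T> B) (sorted_list_of_set B)"
    by metis
  have "\<forall>(x, y, z)\<in>\<T> B. \<not> (x < y \<and> y < z)" if "B \<in> \<B>" for B
  proof -
    have "\<T> B \<subseteq> transitive_triples B"
      using T[OF that] by (simp add: is_DTS_def)
    then show ?thesis
      using good_sequencing_sorted_list_of_set[OF fin[OF that]] good[OF that] by blast
  qed
  \<comment> \<open>All blocks use the same order on the natural numbers, so the conditions for the
    separate blocks combine into one for the union.\<close>
  then have incr: "\<forall>(x, y, z)\<in>\<Union>B\<in>\<B>. \<T> B. \<not> (x < y \<and> y < z)"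
    by blast
  have DTS: "is_DTS v X (\<Union>B\<in>\<B>. \<T> B)"
    using is_DTS_Union[OF PBD] T by blast
  then have "(\<Union>B\<in>\<B>. \<T> B) \<subseteq> transitive_triples X"
    by (simp add: is_DTS_def)
  then have "good_sequencing X (\<Union>B\<in>\<B>. \<T> B) (sorted_list_of_set X)"
    using good_sequencing_sorted_list_of_set[OF X(1)] incr by blast
  with \<open>3 \<le> v\<close> DTS show "v \<in> K_DTS"
    by (rule K_DTS_I)
qed

end
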